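(* Consider the two-stage electricity market with a real-time market power mitigation (MPM) policy and price-taking participants described in the context, with generators $\mathcal{G}$ (cost coefficients $c_j$, estimation errors $\epsilon_j\ge 0$), loads $\mathcal{L}$ (inelastic demands $d_l$) and aggregate demand $d=\sum_{l\in\mathcal{L}}d_l$. The competitive equilibrium exists and is given by $$g_j^{d}+g_j^{r}=\frac{(c_j+\epsilon_j)^{-1}}{\sum_{k\in\mathcal{G}}(c_k+\epsilon_k)^{-1}}\,d,\qquad \theta_j^{d}\in\mathbb{R}_{\ge 0},\qquad \forall j\in\mathcal{G},$$ $$d_l^{d}+d_l^{r}=d_l,\qquad \forall l\in\mathcal{L},$$ $$\lambda^{d}=\lambda^{r}=\frac{d}{\sum_{k\in\mathcal{G}}(c_k+\epsilon_k)^{-1}}.$$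
   Context: Setting. $\mathcal{G}$ is a finite set of generators and $\mathcal{L}$ a finite set of loads. Generator $j$ has cost $\frac{c_j}{2}g_j^2$, $c_j>0$, for total output $g_j=g_j^d+g_j^r\in\mathbb{R}$ (superscripts $d$, $r$: day-ahead, real-time). Load $l$ has fixed (inelastic) demand $d_l\in\mathbb{R}$, split over the two stages as $d_l=d_l^d+d_l^r$. Put $d=\sum_l d_l\in\mathbb{R}$, $d^d=\sum_l d_l^d$, $d^r=\sum_l d_l^r$. The stage prices are $\lambda^d,\lambda^r$. Day-ahead stage. Generator $j$ submits a linear supply function with slope $\theta_j^d$, so that $g_j^d=\theta_j^d\lambda^d$; load $l$ bids the quantity $d_l^d$. The market clears according to $\sum_{j\in\mathcal{G}}\theta_j^d\lambda^d=d^d$. Conventions for degenerate cases in a stage: if net supply and net demand in the stage are both zero, its price is set equal to the price of the other stage (with nonzero demand); if net supply is zero and net demand is nonzero, its price is set to zero and demand is split evenly across all loads. Real-time stage with MPM policy. Generators' real-time bids are ignored. The operator estimates the cost coefficient of generator $j$ as $c_j+\epsilon_j$ with error $\epsilon_j\ge 0$ and, given $g_j^d$, dispatches $g_j^{r}=(c_j+\epsilon_j)^{-1}\lambda^{r}-g_j^{d}$. Together with the two-stage balance $\sum_j(g_j^d+g_j^r)=d$ this gives $\lambda^{r}=d/\sum_{k\in\mathcal{G}}(c_k+\epsilon_k)^{-1}$. Price-taking participants. A participant is price-taking if it accepts the existing prices and does not anticipate the impact of its bid on them. With $\omega_j:=(c_j+\epsilon_j)^{-1}/\sum_{k}(c_k+\epsilon_k)^{-1}$,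 generator $j$, given $\lambda^d$, chooses $\theta_j^d$ to maximize its profit $$\pi_j=\theta_j^{d}(\lambda^{d})^2+\lambda^r\left(\omega_j d-\theta_j^{d}\lambda^{d}\right)-\tfrac{c_j}{2}(\omega_j d)^2,\qquad \lambda^r=\frac{d}{\sum_{k}(c_k+\epsilon_k)^{-1}},$$ and load $l$, given prices, chooses $d_l^d$ to minimize its payment $\rho_l=\lambda^d d_l^d+\lambda^r(d_l-d_l^d)$. A competitive equilibrium is a collection of bids and prices such that each price-taking generator's bid maximizes its profit, each price-taking load's allocation minimizes its payment, and the inelastic demand $d$ is satisfied over the two stages with the market-clearing prices: $\lambda^d$ from day-ahead clearing and $\lambda^r$ as given by the MPM policy. *)

theory Defs
  imports Complex_Main
begin

record ('g, 'l) market =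
  gens :: "'g set"
  loads :: "'l set"
  cost :: "'g \<Rightarrow> real"      \<comment> \<open>\<open>c\<^sub>j\<close>\<close>
  err :: "'g \<Rightarrow> real"       \<comment> \<open>\<open>\<epsilon>\<^sub>j\<close>\<close>
  demand :: "'l \<Rightarrow> real"    \<comment> \<open>\<open>d\<^sub>l\<close>\<close>

definition valid_market :: "('g, 'l) market \<Rightarrow> bool" where
  "valid_market M \<longleftrightarrow>
     finite (gens M) \<and> gens M \<noteq> {} \<and> finite (loads M) \<and>
     (\<forall>j\<in>gens M. cost M j > 0 \<and> err M j \<ge> 0)"

definition total_demand :: "('g, 'l) market \<Rightarrow> real" where
  "total_demand M = (\<Sum>l\<in>loads M. demand M l)"

definition est_slope :: "('g, 'l) market \<Rightarrow> 'g \<Rightarrow> real" where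
  "est_slope M j = inverse (cost M j + err M j)"

definition mpm_price :: "('g, 'l) market \<Rightarrow> real" where
  "mpm_price M = total_demand M / (\<Sum>k\<in>gens M. est_slope M k)"

definition share :: "('g, 'l) market \<Rightarrow> 'g \<Rightarrow> real" where
  "share M j = est_slope M j / (\<Sum>k\<in>gens M. est_slope M k)"

text \<open>Bids, quantities and prices of the two stages. All functions matter only on
  \<open>gens M\<close> and \<open>loads M\<close>.\<close>

record ('g, 'l) outcome =
  slope :: "'g \<Rightarrow> real"     \<comment> \<open>\<open>\<theta>\<^sub>j\<^sup>d\<close>\<close>
  gen_da :: "'g \<Rightarrow> real"    \<comment> \<open>\<open>g\<^sub>j\<^sup>d\<close>\<close>
  gen_rt :: "'g \<Rightarrow> real"    \<comment> \<open>\<open>g\<^sub>j\<^sup>r\<close>\<close>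
  dem_da :: "'l \<Rightarrow> real"    \<comment> \<open>\<open>d\<^sub>l\<^sup>d\<close>\<close>
  dem_rt :: "'l \<Rightarrow> real"    \<comment> \<open>\<open>d\<^sub>l\<^sup>r\<close>\<close>
  price_da :: real          \<comment> \<open>\<open>\<lambda>\<^sup>d\<close>\<close>
  price_rt :: real          \<comment> \<open>\<open>\<lambda>\<^sup>r\<close>\<close>

text \<open>Day-ahead clearing \<open>\<Sum>\<^sub>j \<theta>\<^sub>j\<^sup>d \<lambda>\<^sup>d = d\<^sup>d\<close> with the conventions for the degenerate cases.
  ``Net supply is zero'' is read as a vanishing aggregate supply function,
  i.e. \<open>\<Sum>\<^sub>j \<theta>\<^sub>j\<^sup>d = 0\<close>: exactly then the clearing equation does not determine the price.\<close>

definition day_ahead_clearing :: "('g, 'l) market \<Rightarrow> ('g, 'l) outcome \<Rightarrow> bool" where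
  "day_ahead_clearing M E \<longleftrightarrow>
     (\<forall>j\<in>gens M. gen_da E j = slope E j * price_da E) \<and>
     (let S = (\<Sum>j\<in>gens M. slope E j); D = (\<Sum>l\<in>loads M. dem_da E l) in
      if S = 0 \<and> D = 0 then price_da E = price_rt E
      else if S = 0 then
        price_da E = 0 \<and> (\<forall>l\<in>loads M. dem_da E l = D / real (card (loads M)))
      else (\<Sum>j\<in>gens M. slope E j * price_da E) = D)"

text \<open>The real-time dispatch under the mitigation policy together with the two-stage balance;
  these two conditions force \<open>price_rt E = mpm_price M\<close>.\<close>

definition mpm_dispatch :: "('g, 'l) market \<Rightarrow> ('g, 'l) outcome \<Rightarrow> bool" where
  "mpm_dispatch M E \<longleftrightarrow>
     (\<forall>j\<in>gens M. gen_rt E j = est_slope M j * price_rt E - gen_da E j) \<and>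
     (\<Sum>j\<in>gens M. gen_da E j + gen_rt E j) = total_demand M"

definition profit :: "('g, 'l) market \<Rightarrow> real \<Rightarrow> 'g \<Rightarrow> real \<Rightarrow> real" where
  "profit M p j \<theta> =
     \<theta> * p\<^sup>2 + mpm_price M * (share M j * total_demand M - \<theta> * p)
       - cost M j / 2 * (share M j * total_demand M)\<^sup>2"

definition payment :: "('g, 'l) market \<Rightarrow> real \<Rightarrow> real \<Rightarrow> 'l \<Rightarrow> real \<Rightarrow> real" where
  "payment M p q l x = p * x + q * (demand M l - x)"

text \<open>Supply functions have nonnegative slope, so generators optimize over \<open>\<theta> \<ge> 0\<close>;
  the day-ahead quantity of a load is an arbitrary real. Participants are price-taking: the
  prices stay fixed when a bid varies.\<close>

definition competitive_equilibrium :: "('g, 'l) market \<Rightarrow> ('g, 'l) outcome \<Rightarrow> bool" where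
  "competitive_equilibrium M E \<longleftrightarrow>
     (\<forall>j\<in>gens M. is_arg_max (profit M (price_da E) j) (\<lambda>\<theta>. \<theta> \<ge> 0) (slope E j)) \<and>
     (\<forall>l\<in>loads M.
        is_arg_min (payment M (price_da E) (price_rt E) l) (\<lambda>x. True) (dem_da E l)) \<and>
     (\<forall>l\<in>loads M. dem_da E l + dem_rt E l = demand M l) \<and>
     day_ahead_clearing M E \<and> mpm_dispatch M E"

end

theory Submission
  imports Defs
begin

text \<open>For fixed prices, both the profit in the slope and the payment in the day-ahead quantity
  are affine, with slopes \<open>\<lambda>\<^sup>d (\<lambda>\<^sup>d - \<lambda>\<^sup>r)\<close> and \<open>\<lambda>\<^sup>d - \<lambda>\<^sup>r\<close>. A load optimizes over the whole line, so an
  optimum exists only if the prices agree, and then every bid of every participant is optimal.\<close>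

lemma is_arg_min_affine_iff:
  fixes a b x :: real
  shows "is_arg_min (\<lambda>x. a * x + b) (\<lambda>_. True) x \<longleftrightarrow> a = 0"
proof
  assume "is_arg_min (\<lambda>x. a * x + b) (\<lambda>_. True) x"
  \<comment> \<open>The competitor \<open>x - a\<close> is a descent step: it changes the value by
    \<open>- a * a\<close>, which is negative unless \<open>a = 0\<close>.\<close>
  then have "\<not> a * (x - a) + b < a * x + b"
    by (simp add: is_arg_min_def)
  then have "a * a \<le> 0"
    by (simp add: algebra_simps)
  then show "a = 0"
    by (auto simp: mult_le_0_iff)
qed (simp add: is_arg_min_def)

text \<open>Complementary slackness on a half-line: an upper bound exists only for a nonpositive
  coefficient, and then a maximizer sits at the boundary 0 unless the coefficient vanishes.\<close>

lemma is_arg_max_affine_nonneg_iff: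
  fixes a b x :: real
  shows "is_arg_max (\<lambda>x. a * x + b) (\<lambda>x. x \<ge> 0) x \<longleftrightarrow> x \<ge> 0 \<and> a \<le> 0 \<and> a * x = 0"
proof
  assume opt: "is_arg_max (\<lambda>x. a * x + b) (\<lambda>x. x \<ge> 0) x"
  then have x: "x \<ge> 0"
    by (simp add: is_arg_max_def)
  have le: "a * y \<le> a * x" if "y \<ge> 0" for y
    using opt that by (auto simp: is_arg_max_def not_less)
  have "a \<le> 0"
    using le[of "x + 1"] x by (simp add: algebra_simps)
  moreover have "a * x = 0"
    using le[of 0] mult_nonpos_nonneg[OF \<open>a \<le> 0\<close> x] by simp
  ultimately show "x \<ge> 0 \<and> a \<le> 0 \<and> a * x = 0"
    using x by simp
next
  assume "x \<ge> 0 \<and> a \<le> 0 \<and> a * x = 0"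
  then show "is_arg_max (\<lambda>x. a * x + b) (\<lambda>x. x \<ge> 0) x"
    by (auto simp: is_arg_max_def not_less mult_nonpos_nonneg)
qed

lemma payment_optimal_iff:
  "is_arg_min (payment M p q l) (\<lambda>x. True) x \<longleftrightarrow> p = q"
proof -
  have "payment M p q l = (\<lambda>x. (p - q) * x + q * demand M l)"
    by (auto simp: payment_def algebra_simps)
  then show ?thesis
    by (simp add: is_arg_min_affine_iff)
qed

lemma profit_optimal_iff:
  "is_arg_max (profit M p j) (\<lambda>\<theta>. \<theta> \<ge> 0) \<theta> \<longleftrightarrow>
     \<theta> \<ge> 0 \<and> p * (p - mpm_price M) \<le> 0 \<and> p * (p - mpm_price M) * \<theta> = 0"
proof -
  have "profit M p j = (\<lambda>\<theta>. p * (p - mpm_price M) * \<theta> +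
      (mpm_price M * (share M j * total_demand M)
        - cost M j / 2 * (share M j * total_demand M)\<^sup>2))"
    by (auto simp: profit_def algebra_simps power2_eq_square)
  then show ?thesis
    by (simp only: is_arg_max_affine_nonneg_iff)
qed

lemma sum_est_slope_pos:
  assumes "valid_market M"
  shows "(\<Sum>k\<in>gens M. est_slope M k) > 0"
  using assms by (intro sum_pos) (auto simp: valid_market_def est_slope_def add_pos_nonneg)

text \<open>Summing the dispatch rule cancels the day-ahead quantities, so the balance is one linear
  equation in the real-time price, solvable because the estimated slopes have positive sum.\<close>

lemma mpm_dispatch_iff:
  assumes "valid_market M"
  shows "mpm_dispatch M E \<longleftrightarrow>
    price_rt E = mpm_price M \<and>
    (\<forall>j\<in>gens M. gen_da E j + gen_rt E j = share M j * total_demand M)"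
proof -
  have S: "(\<Sum>k\<in>gens M. est_slope M k) \<noteq> 0"
    using sum_est_slope_pos[OF assms] by simp
  have bal: "(\<Sum>j\<in>gens M. est_slope M j * price_rt E) = total_demand M \<longleftrightarrow>
      price_rt E = mpm_price M"
    using S by (simp add: mpm_price_def sum_distrib_left eq_divide_eq mult.commute)
  have "mpm_dispatch M E \<longleftrightarrow>
      (\<forall>j\<in>gens M. gen_da E j + gen_rt E j = est_slope M j * price_rt E) \<and>
      (\<Sum>j\<in>gens M. gen_da E j + gen_rt E j) = total_demand M"
    by (auto simp: mpm_dispatch_def)
  also have "\<dots> \<longleftrightarrow>
      (\<forall>j\<in>gens M. gen_da E j + gen_rt E j = est_slope M j * price_rt E) \<and>
      price_rt E = mpm_price M"
  \<comment> \<open>The balance is rewritten under the dispatch rule, which turns each total output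
    into a multiple of the price.\<close>
  proof (rule conj_cong)
    assume "\<forall>j\<in>gens M. gen_da E j + gen_rt E j = est_slope M j * price_rt E"
    then have "(\<Sum>j\<in>gens M. gen_da E j + gen_rt E j) =
        (\<Sum>j\<in>gens M. est_slope M j * price_rt E)"
      by (intro sum.cong) auto
    then show "(\<Sum>j\<in>gens M. gen_da E j + gen_rt E j) = total_demand M \<longleftrightarrow>
        price_rt E = mpm_price M"
      by (simp only: bal)
  qed (rule refl)
  also have "\<dots> \<longleftrightarrow> price_rt E = mpm_price M \<and>
      (\<forall>j\<in>gens M. gen_da E j + gen_rt E j = share M j * total_demand M)"
    by (auto simp: mpm_price_def share_def)
  finally show ?thesis .
qed

text \<open>The generators alone only confine the day-ahead price between 0 and the mitigated price;
  a single load already forces equality.\<close>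

lemma competitive_equilibrium_prices:
  assumes "valid_market M" and eq: "competitive_equilibrium M E"
  shows "price_da E = price_rt E" "price_rt E = mpm_price M"
proof -
  show rt: "price_rt E = mpm_price M"
    using eq mpm_dispatch_iff[OF assms(1)] by (simp add: competitive_equilibrium_def)
  show "price_da E = price_rt E"
  proof (cases "loads M = {}")
    case False
    then show ?thesis
      using eq by (auto simp: competitive_equilibrium_def payment_optimal_iff)
  next
    case True
    \<comment> \<open>Without loads the demand, hence the real-time price, is zero, and only the generators
      force the day-ahead price: their profit \<open>\<theta> (\<lambda>\<^sup>d)\<^sup>2\<close> must be bounded.\<close>
    then have "mpm_price M = 0"
      by (simp add: mpm_price_def total_demand_def)
    moreover obtain j where "j \<in> gens M"
      using assms(1) by (auto simp: valid_market_def)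
    ultimately have "price_da E * price_da E \<le> 0"
      using eq by (auto simp: competitive_equilibrium_def profit_optimal_iff)
    then show ?thesis
      using rt \<open>mpm_price M = 0\<close> by (auto simp: mult_le_0_iff)
  qed
qed

text \<open>At equal prices, optimality leaves only the sign condition on the slopes; at any other
  prices both sides are false.\<close>

lemma competitive_equilibrium_iff:
  assumes "valid_market M"
  shows "competitive_equilibrium M E \<longleftrightarrow>
    day_ahead_clearing M E \<and>
    (\<forall>j\<in>gens M. gen_da E j + gen_rt E j = share M j * total_demand M \<and> slope E j \<ge> 0) \<and>
    (\<forall>l\<in>loads M. dem_da E l + dem_rt E l = demand M l) \<and>
    price_da E = price_rt E \<and> price_rt E = mpm_price M"
proof (cases "price_da E = price_rt E \<and> price_rt E = mpm_price M")
  case True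
  then show ?thesis
    by (auto simp: competitive_equilibrium_def payment_optimal_iff profit_optimal_iff
        mpm_dispatch_iff[OF assms])
next
  case False
  then show ?thesis
    using competitive_equilibrium_prices[OF assms] by blast
qed

lemma competitive_equilibrium_exists:
  assumes "valid_market M"
  shows "\<exists>E. competitive_equilibrium M E"
proof
  \<comment> \<open>All trade moves to real time. Day-ahead supply and demand both vanish, so the
    degenerate convention itself equates the two prices.\<close>
  show "competitive_equilibrium M
    \<lparr>slope = \<lambda>_. 0, gen_da = \<lambda>_. 0, gen_rt = \<lambda>j. share M j * total_demand M,
     dem_da = \<lambda>_. 0, dem_rt = demand M, price_da = mpm_price M, price_rt = mpm_price M\<rparr>"
    by (simp add: competitive_equilibrium_iff[OF assms] day_ahead_clearing_def)
qed

theorem theorem3: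
  fixes M :: "('g, 'l) market"
  assumes "valid_market M"
  shows "(\<exists>E. competitive_equilibrium M E) \<and>
    (\<forall>E. competitive_equilibrium M E \<longleftrightarrow>
       day_ahead_clearing M E \<and>
       (\<forall>j\<in>gens M.
          gen_da E j + gen_rt E j =
            inverse (cost M j + err M j) / (\<Sum>k\<in>gens M. inverse (cost M k + err M k))
              * (\<Sum>l\<in>loads M. demand M l) \<and>
          slope E j \<ge> 0) \<and>
       (\<forall>l\<in>loads M. dem_da E l + dem_rt E l = demand M l) \<and>
       price_da E = price_rt E \<and>
       price_rt E =
         (\<Sum>l\<in>loads M. demand M l) / (\<Sum>k\<in>gens M. inverse (cost M k + err M k)))"
  using competitive_equilibrium_exists[OF assms] competitive_equilibrium_iff[OF assms]
  unfolding share_def mpm_price_def total_demand_def est_slope_def by blast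

end
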